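(* Let $M$ be a closed subspace of a Banach space $Z$, and let $K\colon Z\to Z$ be a weakly compact bounded operator with $\|K\|<1$. Put $N=(I-K)(M)$. Then both pairs $(M,N)$ and $(N,M)$ of closed subspaces of $Z$ belong to $\mathcal{W}$ (that is, are weakly compact pairs).
   Context: For a closed subspace $M$ of a Banach space $Z$, $J_M\colon M\to Z$ denotes the inclusion and $Q_M\colon Z\to Z/M$ the quotient map. An ordered pair $(M,N)$ of closed subspaces of $Z$ is called weakly compact, written $(M,N)\in\mathcal{W}$, if the bounded operator $Q_NJ_M\colon M\to Z/N$ is weakly compact (maps bounded sets to relatively weakly compact sets). *)

theory Defs
  imports "HOL-Analysis.Analysis"
begin

text \<open>
  The quotient of a type by a term-level subspace is not a type, so normed spaces are represented
  by explicit structures with a carrier. The scalar field ranges over the class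
  \<open>real_normed_field\<close>, so that real and complex spaces are both covered.
\<close>

record ('k, 'a) nspace =
  ns_carrier :: "'a set"
  ns_add :: "'a \<Rightarrow> 'a \<Rightarrow> 'a"
  ns_scale :: "'k \<Rightarrow> 'a \<Rightarrow> 'a"
  ns_norm :: "'a \<Rightarrow> real"

definition bounded_operator ::
    "('k, 'a) nspace \<Rightarrow> ('k, 'b) nspace \<Rightarrow> ('a \<Rightarrow> 'b) \<Rightarrow> bool" where
  "bounded_operator X Y T \<longleftrightarrow>
     (\<forall>x\<in>ns_carrier X. T x \<in> ns_carrier Y) \<and>
     (\<forall>x\<in>ns_carrier X. \<forall>y\<in>ns_carrier X. T (ns_add X x y) = ns_add Y (T x) (T y)) \<and>
     (\<forall>c. \<forall>x\<in>ns_carrier X. T (ns_scale X c x) = ns_scale Y c (T x)) \<and>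
     (\<exists>C. \<forall>x\<in>ns_carrier X. ns_norm Y (T x) \<le> C * ns_norm X x)"

definition scalar_nspace :: "('k::real_normed_field, 'k) nspace" where
  "scalar_nspace = \<lparr>ns_carrier = UNIV, ns_add = (+), ns_scale = (*), ns_norm = norm\<rparr>"

definition dual :: "('k::real_normed_field, 'a) nspace \<Rightarrow> ('a \<Rightarrow> 'k) set" where
  "dual X = {f. bounded_operator X scalar_nspace f}"

definition weak_topology :: "('k::real_normed_field, 'a) nspace \<Rightarrow> 'a topology" where
  "weak_topology X =
     topology_generated_by {{x \<in> ns_carrier X. f x \<in> U} |f U. f \<in> dual X \<and> open U}"

definition weakly_compact_operator ::
    "('k::real_normed_field, 'a) nspace \<Rightarrow> ('k, 'b) nspace \<Rightarrow> ('a \<Rightarrow> 'b) \<Rightarrow> bool" where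
  "weakly_compact_operator X Y T \<longleftrightarrow>
     bounded_operator X Y T \<and>
     (\<forall>B. B \<subseteq> ns_carrier X \<and> (\<exists>r. \<forall>x\<in>B. ns_norm X x \<le> r) \<longrightarrow>
        compactin (weak_topology Y) (weak_topology Y closure_of (T ` B)))"

text \<open>
  A Banach space over \<open>'k\<close>: the type class supplies the complete norm, and \<open>smul\<close> the scalar
  multiplication. For \<open>'k = real\<close> the last axiom forces \<open>smul = scaleR\<close>.
\<close>

locale banach_space_over = vector_space smul
  for smul :: "'k::real_normed_field \<Rightarrow> 'a::banach \<Rightarrow> 'a" +
  assumes norm_scale: "norm (smul c x) = norm c * norm x"
    and scale_of_real: "smul (of_real r) x = r *\<^sub>R x"

definition subspace_nspace ::
    "('k \<Rightarrow> 'a \<Rightarrow> 'a) \<Rightarrow> 'a::real_normed_vector set \<Rightarrow> ('k, 'a) nspace" where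
  "subspace_nspace smul M = \<lparr>ns_carrier = M, ns_add = (+), ns_scale = smul, ns_norm = norm\<rparr>"

abbreviation whole_nspace :: "('k \<Rightarrow> 'a \<Rightarrow> 'a) \<Rightarrow> ('k, 'a::real_normed_vector) nspace" where
  "whole_nspace smul \<equiv> subspace_nspace smul UNIV"

definition quotient_map_by :: "'a::real_normed_vector set \<Rightarrow> 'a \<Rightarrow> 'a set" where
  "quotient_map_by N x = (\<lambda>n. x + n) ` N"

text \<open>
  The scalar multiple of a coset adds \<open>N\<close> again because \<open>smul 0\<close> would otherwise
  collapse the coset to a single point.
\<close>

definition quotient_nspace ::
    "('k \<Rightarrow> 'a \<Rightarrow> 'a) \<Rightarrow> 'a::real_normed_vector set \<Rightarrow> ('k, 'a set) nspace" where
  "quotient_nspace smul N =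
     \<lparr>ns_carrier = range (quotient_map_by N),
      ns_add = (\<lambda>A B. {a + b |a b. a \<in> A \<and> b \<in> B}),
      ns_scale = (\<lambda>c A. {smul c a + n |a n. a \<in> A \<and> n \<in> N}),
      ns_norm = (\<lambda>A. Inf (norm ` A))\<rparr>"

lemma quotient_add:
  assumes "module smul" "module.subspace smul N"
  shows "ns_add (quotient_nspace smul N) (quotient_map_by N x) (quotient_map_by N y) =
         quotient_map_by N (x + y)"
proof -
  interpret module smul by fact
  have N: "0 \<in> N" "\<And>a b. a \<in> N \<Longrightarrow> b \<in> N \<Longrightarrow> a + b \<in> N"
    using assms(2) by (auto simp: subspace_def)
  have 1: "x + m + (y + n) \<in> quotient_map_by N (x + y)" if "m \<in> N" "n \<in> N" for m n
    unfolding quotient_map_by_def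
    by (rule image_eqI[of _ _ "m + n"]) (use that N in \<open>auto simp: algebra_simps\<close>)
  have 2: "x + y + k = (x + 0) + (y + k)" for k
    by (simp add: algebra_simps)
  have "{a + b |a b. a \<in> quotient_map_by N x \<and> b \<in> quotient_map_by N y} = quotient_map_by N (x + y)"
  proof (intro equalityI subsetI)
    fix z assume "z \<in> {a + b |a b. a \<in> quotient_map_by N x \<and> b \<in> quotient_map_by N y}"
    then obtain m n where "m \<in> N" "n \<in> N" "z = x + m + (y + n)"
      unfolding quotient_map_by_def by blast
    then show "z \<in> quotient_map_by N (x + y)" using 1 by blast
  next
    fix z assume "z \<in> quotient_map_by N (x + y)"
    then obtain k where "k \<in> N" "z = x + y + k"
      unfolding quotient_map_by_def by blast
    then show "z \<in> {a + b |a b. a \<in> quotient_map_by N x \<and> b \<in> quotient_map_by N y}"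
      using 2 N(1) unfolding quotient_map_by_def by blast
  qed
  then show ?thesis by (simp add: quotient_nspace_def)
qed

lemma quotient_scale:
  assumes "module smul" "module.subspace smul N"
  shows "ns_scale (quotient_nspace smul N) c (quotient_map_by N x) =
         quotient_map_by N (smul c x)"
proof -
  interpret module smul by fact
  have N: "0 \<in> N" "\<And>a b. a \<in> N \<Longrightarrow> b \<in> N \<Longrightarrow> a + b \<in> N" "\<And>a. a \<in> N \<Longrightarrow> smul c a \<in> N"
    using assms(2) by (auto simp: subspace_def)
  have 1: "smul c (x + m) + n \<in> quotient_map_by N (smul c x)" if "m \<in> N" "n \<in> N" for m n
    unfolding quotient_map_by_def
    by (rule image_eqI[of _ _ "smul c m + n"]) (use that N in \<open>auto simp: scale_right_distrib add.assoc\<close>)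
  have 2: "smul c x + k = smul c (x + 0) + k" for k
    by simp
  have "{smul c a + n |a n. a \<in> quotient_map_by N x \<and> n \<in> N} = quotient_map_by N (smul c x)"
  proof (intro equalityI subsetI)
    fix z assume "z \<in> {smul c a + n |a n. a \<in> quotient_map_by N x \<and> n \<in> N}"
    then obtain m n where "m \<in> N" "n \<in> N" "z = smul c (x + m) + n"
      unfolding quotient_map_by_def by blast
    then show "z \<in> quotient_map_by N (smul c x)" using 1 by blast
  next
    fix z assume "z \<in> quotient_map_by N (smul c x)"
    then obtain k where "k \<in> N" "z = smul c x + k"
      unfolding quotient_map_by_def by blast
    then show "z \<in> {smul c a + n |a n. a \<in> quotient_map_by N x \<and> n \<in> N}"
      using 2 N(1) unfolding quotient_map_by_def by blast
  qed
  then show ?thesis by (simp add: quotient_nspace_def)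
qed

lemma quotient_norm:
  assumes "module smul" "module.subspace smul N"
  shows "ns_norm (quotient_nspace smul N) (quotient_map_by N x) = infdist x N"
proof -
  interpret module smul by fact
  have "0 \<in> N" and neg: "\<And>a. a \<in> N \<Longrightarrow> - a \<in> N"
    using assms(2) subspace_0 subspace_neg by auto
  have "uminus ` N = N" using neg by (force simp: image_iff)
  then have "(\<lambda>n. norm (x + n)) ` N = (\<lambda>n. norm (x + n)) ` uminus ` N" by simp
  also have "\<dots> = (\<lambda>n. dist x n) ` N" by (simp add: image_image dist_norm)
  finally show ?thesis
    using \<open>0 \<in> N\<close> by (auto simp: quotient_nspace_def quotient_map_by_def infdist_def image_image)
qed

lemma topspace_weak_topology: "topspace (weak_topology X) = ns_carrier X"
proof -
  have "(\<lambda>_. 0) \<in> dual X"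
    by (auto simp: dual_def bounded_operator_def scalar_nspace_def intro!: exI[of _ 0])
  then have "\<exists>f U. ns_carrier X = {x \<in> ns_carrier X. f x \<in> U} \<and> f \<in> dual X \<and> open U"
    by (intro exI[of _ "\<lambda>_. 0"] exI[of _ UNIV]) auto
  then show ?thesis
    unfolding weak_topology_def topology_generated_by_topspace by blast
qed

text \<open>
  Since the inclusion \<open>J\<^sub>M\<close> acts as the identity, \<open>Q\<^sub>N J\<^sub>M\<close> is \<open>quotient_map_by N\<close> regarded as a
  map on the carrier \<open>M\<close>.
\<close>

definition weakly_compact_pairs ::
    "('k::real_normed_field \<Rightarrow> 'a \<Rightarrow> 'a) \<Rightarrow> ('a::real_normed_vector set \<times> 'a set) set" where
  "weakly_compact_pairs smul =
     {(M, N). module.subspace smul M \<and> closed M \<and> module.subspace smul N \<and> closed N \<and>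
        weakly_compact_operator (subspace_nspace smul M) (quotient_nspace smul N)
          (quotient_map_by N)}"

end

theory Submission
  imports Defs
begin

text \<open>
  For \<open>x \<in> M\<close> the vector \<open>x - K x\<close> lies in \<open>N\<close>, so \<open>Q\<^sub>N x = Q\<^sub>N K x\<close> and \<open>Q\<^sub>N J\<^sub>M = Q\<^sub>N K J\<^sub>M\<close>.
  Likewise \<open>Q\<^sub>M (x - K x) = Q\<^sub>M K (- x)\<close>, and \<open>\<parallel>K\<parallel> < 1\<close> makes \<open>x\<close> depend boundedly on
  \<open>x - K x\<close>. Thus both operators map bounded sets into sets \<open>Q K B\<close> with \<open>B\<close> bounded.
  Weak topologies are regular, and in a regular space the closure of a subset of a compact set
  is compact; this avoids any appeal to Hahn-Banach for separation in the quotients.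
\<close>

section \<open>Compact closures in regular spaces\<close>

lemma compactin_closure_of_subset_regular:
  assumes X: "regular_space X" and S: "compactin X S" and "A \<subseteq> S"
  shows "compactin X (X closure_of A)"
proof -
  \<comment> \<open>Without a Hausdorff assumption \<open>S\<close> may fail to be closed, so its
    closure is treated first; the closure of \<open>A\<close> is then a closed subset of a compact
    set.\<close>
  have "compactin X (X closure_of S)"
    unfolding compactin_def
  proof (intro conjI allI impI)
    fix \<U> assume \<U>: "Ball \<U> (openin X) \<and> X closure_of S \<subseteq> \<Union> \<U>"
    moreover have "S \<subseteq> X closure_of S"
      by (simp add: S closure_of_subset compactin_subset_topspace)
    ultimately obtain \<F> where \<F>: "finite \<F>" "\<F> \<subseteq> \<U>" "S \<subseteq> \<Union> \<F>"
      using S unfolding compactin_def by (metis subset_trans)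
    \<comment> \<open>The finite family chosen for \<open>S\<close> already covers its closure:
      regularity separates \<open>S\<close> from the uncovered closed set \<open>T\<close>, and the
      complement of \<open>V\<close> is a closed set between \<open>S\<close> and the union of the
      family.\<close>
    define T where "T = topspace X - \<Union> \<F>"
    have "openin X (\<Union> \<F>)" using \<F> \<U> by blast
    then have "closedin X T" unfolding T_def by blast
    moreover have "disjnt S T" using \<F> by (auto simp: T_def disjnt_def)
    ultimately obtain U V where UV: "openin X U" "openin X V" "S \<subseteq> U" "T \<subseteq> V" "disjnt U V"
      by (metis regular_space_compact_closed_separation[OF X S])
    then have "S \<subseteq> topspace X - V"
      using openin_subset[OF UV(1)] by (auto simp: disjnt_def)
    then have "X closure_of S \<subseteq> topspace X - V"
      using UV(2) by (intro closure_of_minimal) auto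
    then have "X closure_of S \<subseteq> \<Union> \<F>" using UV(4) by (auto simp: T_def)
    then show "\<exists>\<F>. finite \<F> \<and> \<F> \<subseteq> \<U> \<and> X closure_of S \<subseteq> \<Union> \<F>" using \<F> by blast
  qed (rule closure_of_subset_topspace)
  then show ?thesis
    by (rule closed_compactin) (simp_all add: closure_of_mono \<open>A \<subseteq> S\<close>)
qed

section \<open>Regularity of weak topologies\<close>

lemma openin_weak_topology_vimage:
  "f \<in> dual X \<Longrightarrow> open U \<Longrightarrow> openin (weak_topology X) {x \<in> ns_carrier X. f x \<in> U}"
  unfolding weak_topology_def by (rule topology_generated_by_Basis) blast

lemma closedin_weak_topology_vimage:
  assumes "f \<in> dual X" "closed C"
  shows "closedin (weak_topology X) {x \<in> ns_carrier X. f x \<in> C}"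
proof -
  have "ns_carrier X - {x \<in> ns_carrier X. f x \<in> C} = {x \<in> ns_carrier X. f x \<in> - C}" by auto
  then show ?thesis
    unfolding closedin_def topspace_weak_topology
    using openin_weak_topology_vimage[of f X "- C"] assms by auto
qed

text \<open>Regularity is pulled back from the scalar field along each functional. Having a closed
  neighbourhood inside the given open set survives finite intersections and arbitrary unions, so it
  passes from the subbasis to all open sets by induction.\<close>

lemma regular_space_weak_topology: "regular_space (weak_topology X)"
proof -
  let ?W = "weak_topology X"
  let ?S = "{{x \<in> ns_carrier X. f x \<in> U} |f U. f \<in> dual X \<and> open U}"
  have "\<forall>x\<in>G. \<exists>U V. openin ?W U \<and> closedin ?W V \<and> x \<in> U \<and> U \<subseteq> V \<and> V \<subseteq> G"
    if "generate_topology_on ?S G" for G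
    using that
  proof induction
    case Empty
    show ?case by simp
  next
    case (Int a b)
    show ?case
    proof
      fix x assume "x \<in> a \<inter> b"
      then obtain U V U' V' where
        "openin ?W U" "closedin ?W V" "x \<in> U" "U \<subseteq> V" "V \<subseteq> a"
        "openin ?W U'" "closedin ?W V'" "x \<in> U'" "U' \<subseteq> V'" "V' \<subseteq> b"
        using Int.IH by (meson IntD1 IntD2)
      then show "\<exists>U V. openin ?W U \<and> closedin ?W V \<and> x \<in> U \<and> U \<subseteq> V \<and> V \<subseteq> a \<inter> b"
        by (intro exI[of _ "U \<inter> U'"] exI[of _ "V \<inter> V'"]) auto
    qed
  next
    case (UN \<K>)
    show ?case
    proof
      fix x assume "x \<in> \<Union> \<K>"
      then obtain k where "k \<in> \<K>" "x \<in> k" by blast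
      with UN.IH[of k] show "\<exists>U V. openin ?W U \<and> closedin ?W V \<and> x \<in> U \<and> U \<subseteq> V \<and> V \<subseteq> \<Union> \<K>"
        by (meson Union_upper subset_trans)
    qed
  next
    case (Basis s)
    then obtain f U where f: "f \<in> dual X" "open U" and s: "s = {x \<in> ns_carrier X. f x \<in> U}"
      by blast
    show ?case
    proof
      fix x assume x: "x \<in> s"
      then obtain e where e: "e > 0" "cball (f x) e \<subseteq> U"
        using f(2) s open_contains_cball by blast
      show "\<exists>U V. openin ?W U \<and> closedin ?W V \<and> x \<in> U \<and> U \<subseteq> V \<and> V \<subseteq> s"
      proof (intro exI conjI)
        show "openin ?W {y \<in> ns_carrier X. f y \<in> ball (f x) e}"
          using f by (intro openin_weak_topology_vimage) auto
        show "closedin ?W {y \<in> ns_carrier X. f y \<in> cball (f x) e}"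
          using f by (intro closedin_weak_topology_vimage) auto
      qed (use x e s in auto)
    qed
  qed
  then show ?thesis
    unfolding neighbourhood_base_of_closedin[symmetric] neighbourhood_base_of
    by (auto simp: weak_topology_def openin_topology_generated_by_iff)
qed

section \<open>Weak continuity and factorizations through a weakly compact operator\<close>

lemma dual_comp_bounded_operator:
  assumes T: "bounded_operator X Y T" and f: "f \<in> dual Y"
    and nonneg: "\<And>y. y \<in> ns_carrier Y \<Longrightarrow> 0 \<le> ns_norm Y y"
  shows "(\<lambda>x. f (T x)) \<in> dual X"
proof -
  obtain C where C: "\<And>x. x \<in> ns_carrier X \<Longrightarrow> ns_norm Y (T x) \<le> C * ns_norm X x"
    using T unfolding bounded_operator_def by blast
  obtain D where D: "\<forall>y\<in>ns_carrier Y. norm (f y) \<le> D * ns_norm Y y"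
    using f unfolding dual_def bounded_operator_def scalar_nspace_def by auto
  \<comment> \<open>The bound \<open>D\<close> for \<open>f\<close> may be negative; its absolute
    value makes the multiplication monotone.\<close>
  have "norm (f (T x)) \<le> \<bar>D\<bar> * C * ns_norm X x" if x: "x \<in> ns_carrier X" for x
  proof -
    have Tx: "T x \<in> ns_carrier Y" using T x unfolding bounded_operator_def by blast
    have "norm (f (T x)) \<le> D * ns_norm Y (T x)" using D Tx by blast
    also have "\<dots> \<le> \<bar>D\<bar> * ns_norm Y (T x)"
      by (rule mult_right_mono) (use nonneg[OF Tx] in auto)
    also have "\<dots> \<le> \<bar>D\<bar> * (C * ns_norm X x)"
      by (rule mult_left_mono) (use C[OF x] in auto)
    finally show ?thesis by (simp add: mult.assoc)
  qed
  then show ?thesis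
    using T f unfolding dual_def bounded_operator_def scalar_nspace_def by auto
qed

text \<open>Functionals pull back to functionals along \<open>T\<close>, so preimages of subbasic
  sets are subbasic. Since \<open>nspace\<close> carries no norm axioms, \<open>nonneg\<close> is a
  separate hypothesis.\<close>

lemma continuous_map_weak_topology:
  assumes T: "bounded_operator X Y T"
    and nonneg: "\<And>y. y \<in> ns_carrier Y \<Longrightarrow> 0 \<le> ns_norm Y y"
  shows "continuous_map (weak_topology X) (weak_topology Y) T"
proof -
  have carrier: "T x \<in> ns_carrier Y" if "x \<in> ns_carrier X" for x
    using T that unfolding bounded_operator_def by blast
  let ?S = "{{y \<in> ns_carrier Y. f y \<in> U} |f U. f \<in> dual Y \<and> open U}"
  show ?thesis
    unfolding weak_topology_def[of Y]
  proof (rule continuous_on_generated_topo)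
    fix G assume "G \<in> ?S"
    then obtain f U where f: "f \<in> dual Y" "open U" and G: "G = {y \<in> ns_carrier Y. f y \<in> U}"
      by blast
    have "T -` G \<inter> topspace (weak_topology X) = {x \<in> ns_carrier X. f (T x) \<in> U}"
      using carrier by (auto simp: G topspace_weak_topology)
    then show "openin (weak_topology X) (T -` G \<inter> topspace (weak_topology X))"
      using openin_weak_topology_vimage[OF dual_comp_bounded_operator[OF T f(1) nonneg] f(2)] by simp
  next
    have "\<Union> ?S = ns_carrier Y"
      using topspace_weak_topology[of Y] unfolding weak_topology_def by simp
    then show "T ` topspace (weak_topology X) \<subseteq> \<Union> ?S"
      using carrier by (auto simp: topspace_weak_topology)
  qed
qed

lemma weakly_compact_operator_factor:
  assumes K: "weakly_compact_operator X Y K"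
    and Q: "bounded_operator Y W Q"
    and T: "bounded_operator V W T"
    and nonneg: "\<And>w. w \<in> ns_carrier W \<Longrightarrow> 0 \<le> ns_norm W w"
    and "0 \<le> C"
    and S: "\<And>v. v \<in> ns_carrier V \<Longrightarrow>
              S v \<in> ns_carrier X \<and> ns_norm X (S v) \<le> C * ns_norm V v \<and> T v = Q (K (S v))"
  shows "weakly_compact_operator V W T"
  unfolding weakly_compact_operator_def
proof (intro conjI allI impI)
  fix B assume "B \<subseteq> ns_carrier V \<and> (\<exists>r. \<forall>x\<in>B. ns_norm V x \<le> r)"
  then obtain r where B: "B \<subseteq> ns_carrier V" and r: "\<And>x. x \<in> B \<Longrightarrow> ns_norm V x \<le> r" by blast
  let ?A = "weak_topology Y closure_of (K ` S ` B)"
  have SB: "S ` B \<subseteq> ns_carrier X" using S B by blast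
  have "ns_norm X (S x) \<le> C * r" if "x \<in> B" for x
    using S[of x] B that mult_left_mono[OF r[OF that] \<open>0 \<le> C\<close>] by force
  then have "compactin (weak_topology Y) ?A"
    using K SB unfolding weakly_compact_operator_def by blast
  then have "compactin (weak_topology W) (Q ` ?A)"
    using continuous_map_weak_topology[OF Q nonneg] by (rule image_compactin)
  moreover have "K ` S ` B \<subseteq> ?A"
  proof (rule closure_of_subset)
    show "K ` S ` B \<subseteq> topspace (weak_topology Y)"
      using K SB unfolding weakly_compact_operator_def bounded_operator_def topspace_weak_topology
      by blast
  qed
  then have "Q ` K ` S ` B \<subseteq> Q ` ?A" by (rule image_mono)
  moreover have "T ` B = Q ` K ` S ` B"
    unfolding image_image using S B by (intro image_cong) auto
  ultimately show "compactin (weak_topology W) (weak_topology W closure_of (T ` B))"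
    using compactin_closure_of_subset_regular[OF regular_space_weak_topology] by metis
qed (fact T)

section \<open>Quotient maps and the image of a subspace under \<open>I - K\<close>\<close>

context banach_space_over
begin

lemma ns_norm_quotient_nonneg:
  assumes "subspace L" "A \<in> ns_carrier (quotient_nspace smul L)"
  shows "0 \<le> ns_norm (quotient_nspace smul L) A"
proof -
  obtain x where "A = quotient_map_by L x"
    using assms(2) by (auto simp: quotient_nspace_def)
  then show ?thesis
    using quotient_norm[OF module_axioms assms(1)] infdist_nonneg by metis
qed

lemma bounded_operator_quotient_map:
  assumes "subspace L"
  shows "bounded_operator (subspace_nspace smul V) (quotient_nspace smul L) (quotient_map_by L)"
proof -
  \<comment> \<open>The quotient norm is the distance to \<open>L\<close>, which contains 0; hence
    the bound 1.\<close>
  have "infdist x L \<le> norm x" for x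
    using infdist_le[of 0 L x] subspace_0[OF assms] by simp
  then show ?thesis
    unfolding bounded_operator_def
    by (auto simp: quotient_add[OF module_axioms assms] quotient_scale[OF module_axioms assms]
        quotient_norm[OF module_axioms assms] subspace_nspace_def intro!: exI[of _ 1])
       (auto simp: quotient_nspace_def)
qed

lemma quotient_map_eqI:
  assumes L: "subspace L" and d: "x - y \<in> L"
  shows "quotient_map_by L x = quotient_map_by L y"
proof -
  have *: "quotient_map_by L a \<subseteq> quotient_map_by L b" if "a - b \<in> L" for a b
  proof
    fix z assume "z \<in> quotient_map_by L a"
    then obtain n where "n \<in> L" "z = a + n" by (auto simp: quotient_map_by_def)
    then show "z \<in> quotient_map_by L b"
      unfolding quotient_map_by_def
      by (intro image_eqI[of _ _ "(a - b) + n"]) (use that subspace_add[OF L] in auto)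
  qed
  have "y - x \<in> L" using subspace_neg[OF L d] by simp
  with *[OF d] *[of y x] show ?thesis by blast
qed

text \<open>Both pairs are instances of this. As \<open>v\<close> and \<open>K (S v)\<close> lie in
  the same coset of \<open>L\<close>, the quotient map factors through \<open>K\<close>.\<close>

lemma weakly_compact_quotient_map:
  assumes K: "weakly_compact_operator (whole_nspace smul) (whole_nspace smul) K"
    and L: "subspace L" and "0 \<le> C"
    and S: "\<And>v. v \<in> V \<Longrightarrow> norm (S v) \<le> C * norm v \<and> v - K (S v) \<in> L"
  shows "weakly_compact_operator (subspace_nspace smul V) (quotient_nspace smul L) (quotient_map_by L)"
proof (rule weakly_compact_operator_factor[OF K _ _ _ \<open>0 \<le> C\<close>])
  show "0 \<le> ns_norm (quotient_nspace smul L) A" if "A \<in> ns_carrier (quotient_nspace smul L)" for A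
    using ns_norm_quotient_nonneg[OF L that] .
  show "S v \<in> ns_carrier (whole_nspace smul) \<and>
      ns_norm (whole_nspace smul) (S v) \<le> C * ns_norm (subspace_nspace smul V) v \<and>
      quotient_map_by L v = quotient_map_by L (K (S v))"
    if "v \<in> ns_carrier (subspace_nspace smul V)" for v
    using S[of v] that quotient_map_eqI[OF L, of v "K (S v)"] by (simp add: subspace_nspace_def)
qed (rule bounded_operator_quotient_map[OF L])+

lemma bounded_linear_bounded_operator:
  assumes "bounded_operator (whole_nspace smul) (whole_nspace smul) K"
  shows "bounded_linear K"
proof -
  have add: "K (x + y) = K x + K y" and scale: "K (smul c x) = smul c (K x)" for x y c
    using assms by (auto simp: bounded_operator_def subspace_nspace_def)
  obtain C where "\<forall>x. norm (K x) \<le> C * norm x"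
    using assms by (auto simp: bounded_operator_def subspace_nspace_def)
  moreover have "K (r *\<^sub>R x) = r *\<^sub>R K x" for r x
    using scale[of "of_real r" x] by (simp only: scale_of_real)
  ultimately show ?thesis
    by (intro bounded_linear_intro[where K = C]) (simp_all add: add mult.commute)
qed

text \<open>Lets the completeness theorem for images under maps bounded below, stated for real
  subspaces, be applied to \<open>M\<close>.\<close>

lemma real_subspace:
  assumes "subspace L"
  shows "Real_Vector_Spaces.subspace L"
  unfolding Real_Vector_Spaces.subspace_def
proof (intro conjI ballI allI)
  show "r *\<^sub>R x \<in> L" if "x \<in> L" for r x
    using subspace_scale[OF assms that, of "of_real r"] by (simp only: scale_of_real)
qed (use assms in \<open>auto intro: subspace_0 subspace_add\<close>)

lemma subspace_image_diff:
  assumes K: "bounded_operator (whole_nspace smul) (whole_nspace smul) K" and M: "subspace M"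
  shows "subspace ((\<lambda>x. x - K x) ` M)"
proof -
  have add: "K (x + y) = K x + K y" and scale: "K (smul c x) = smul c (K x)" for x y c
    using K by (auto simp: bounded_operator_def subspace_nspace_def)
  show ?thesis
  proof (rule subspaceI)
    show "0 \<in> (\<lambda>x. x - K x) ` M"
      using subspace_0[OF M] add[of 0 0] by (intro image_eqI[of _ _ 0]) auto
  next
    fix u v assume "u \<in> (\<lambda>x. x - K x) ` M" "v \<in> (\<lambda>x. x - K x) ` M"
    then obtain x y where "x \<in> M" "y \<in> M" "u = x - K x" "v = y - K y" by blast
    then show "u + v \<in> (\<lambda>x. x - K x) ` M"
      using subspace_add[OF M] by (intro image_eqI[of _ _ "x + y"]) (auto simp: add)
  next
    fix c u assume "u \<in> (\<lambda>x. x - K x) ` M"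
    then obtain x where "x \<in> M" "u = x - K x" by blast
    then show "smul c u \<in> (\<lambda>x. x - K x) ` M"
      using subspace_scale[OF M]
      by (intro image_eqI[of _ _ "smul c x"]) (auto simp: scale scale_right_diff_distrib)
  qed
qed

end

theorem proposition3p4:
  fixes smul :: "'k::real_normed_field \<Rightarrow> 'z::banach \<Rightarrow> 'z"
    and M N :: "'z set"
    and K :: "'z \<Rightarrow> 'z"
  assumes "banach_space_over smul"
    and "module.subspace smul M" and "closed M"
    and "weakly_compact_operator (whole_nspace smul) (whole_nspace smul) K"
    and "onorm K < 1"
    and "N = (\<lambda>x. x - K x) ` M"
  shows "(M, N) \<in> weakly_compact_pairs smul \<and> (N, M) \<in> weakly_compact_pairs smul"
proof -
  interpret banach_space_over smul by fact
  note M = assms(2) and K = assms(4) and N = assms(6)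
  have K': "bounded_operator (whole_nspace smul) (whole_nspace smul) K"
    using K by (simp add: weakly_compact_operator_def)
  have lin: "bounded_linear K" by (rule bounded_linear_bounded_operator[OF K'])
  have subN: "subspace N" unfolding N by (rule subspace_image_diff[OF K' M])
  \<comment> \<open>\<open>I - K\<close> is bounded below because \<open>onorm K < 1\<close>. This
    gives both the closedness of \<open>N\<close> and the bound on preimages.\<close>
  have lower: "(1 - onorm K) * norm x \<le> norm (x - K x)" for x
    using onorm[OF lin, of x] norm_triangle_ineq2[of x "K x"] by (simp add: algebra_simps)
  have "complete N"
    unfolding N
  proof (rule complete_isometric_image)
    show "0 < 1 - onorm K" using assms(5) by simp
    show "Real_Vector_Spaces.subspace M" by (rule real_subspace[OF M])
    show "bounded_linear (\<lambda>x. x - K x)" by (intro bounded_linear_sub bounded_linear_ident lin)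
    show "complete M" using assms(3) by (simp add: complete_eq_closed)
  qed (use lower in auto)
  then have closedN: "closed N" by (simp add: complete_eq_closed)
  have MN: "weakly_compact_operator (subspace_nspace smul M) (quotient_nspace smul N)
      (quotient_map_by N)"
    by (rule weakly_compact_quotient_map[OF K subN, of 1 M "\<lambda>x. x"]) (auto simp: N)
  \<comment> \<open>\<open>R v\<close> is a preimage of \<open>v\<close> in \<open>M\<close> under
    \<open>I - K\<close>.\<close>
  define R where "R v = (SOME x. x \<in> M \<and> v = x - K x)" for v
  have R: "R v \<in> M" "v = R v - K (R v)" if "v \<in> N" for v
    using someI_ex[of "\<lambda>x. x \<in> M \<and> v = x - K x"] that unfolding R_def N by auto
  have NM: "weakly_compact_operator (subspace_nspace smul N) (quotient_nspace smul M)
      (quotient_map_by M)"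
  \<comment> \<open>The sign is chosen so that \<open>v - K (- R v) = v + K (R v) = R v\<close>,
    which lies in \<open>M\<close>; the constant comes from \<open>lower\<close>.\<close>
  proof (rule weakly_compact_quotient_map[OF K M, of "1 / (1 - onorm K)" N "\<lambda>v. - R v"])
    show "0 \<le> 1 / (1 - onorm K)" using assms(5) by simp
    fix v assume v: "v \<in> N"
    have "(1 - onorm K) * norm (R v) \<le> norm v" using lower[of "R v"] R(2)[OF v] by simp
    then have "norm (R v) \<le> norm v / (1 - onorm K)"
      using assms(5) by (simp add: pos_le_divide_eq mult.commute)
    moreover have "v - K (- R v) = R v"
      using R(2)[OF v] linear_neg[OF bounded_linear.linear[OF lin], of "R v"]
      by (metis diff_minus_eq_add diff_add_cancel)
    ultimately show "norm (- R v) \<le> 1 / (1 - onorm K) * norm v \<and> v - K (- R v) \<in> M"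
      using R(1)[OF v] by simp
  qed
  show ?thesis
    using M assms(3) subN closedN MN NM by (simp add: weakly_compact_pairs_def)
qed

end
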